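(* Assume Data (D1)–(D7) listed in the context, and assume that $PAP_{|D}=0$. Assume that $S(D) \subset D(A)$ and that there exists some $M_1 \in \mathbb{R}$ such that $$PAS = M_1 \,PA \quad\text{on } D.$$ Then $(BS,D)$ is bounded and, for some choice of $P_1\in\{P,P_S\}$, $$\|BSf\|\le \tfrac12 |M_1|\,\|(I-P_1)f\|\quad\text{for all } f\in D.$$
   Context: Data (D): (D1) $(E,\mathcal{F},\mu)$ is a probability space and $H=L^2(E,\mu)$ is the real Hilbert space with usual scalar product $(\cdot,\cdot)_H$ and norm $\|\cdot\|$. (D2) $(L,D(L))$ is a linear operator on $H$ generating a strongly continuous semigroup $(T(t))_{t\ge0}$. (D3) $D\subset D(L)$ is a dense subspace of $H$ which is a core for $(L,D(L))$. (D4) $(S,D(S))$ is a symmetric and $(A,D(A))$ a closed and antisymmetric linear operator on $H$ with $D\subset D(S)\cap D(A)$ and $L_{|D}=S-A$. (D5) $P:H\to H$ is an orthogonal projection with $P(H)\subset D(S)$, $SP=0$, $P(D)\subset D(A)$ and $AP(D)\subset D(A)$. Moreover $P_S:H\to H$, $P_Sf:=Pf+(f,1)_H$. (D6) $(Lf,1)_H=\int_E Lf\,\mathrm{d}\mu=0$ for all $f\in D$. (D7) $1\in D(L)$ and $L1=0$. $AP$ has domain $D(AP)=\{f\in H: Pf\in D(A)\}$; it is closed and densely defined. $B$ is the unique continuous linear extension to $H$ of the (bounded) operator $B:=(I+(AP)^*AP)^{-1}(AP)^*$ defined on $D((AP)^* )$. *)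

theory Defs
  imports "HOL-Probability.Probability"
begin

section \<open>The Hilbert space of square-integrable functions\<close>

definition square_integrable :: "'e measure \<Rightarrow> ('e \<Rightarrow> real) set" where
  "square_integrable M =
     {f. f \<in> borel_measurable M \<and> integrable M (\<lambda>x. (f x)\<^sup>2)}"

text \<open>
  A HOL type cannot depend on the measure \<open>M\<close>, so the Hilbert space \<open>L\<^sup>2(M)\<close> is a type \<open>'h\<close>
  together with the quotient map \<open>q\<close> sending a square-integrable function to its class modulo
  almost-everywhere equality. The clauses determine \<open>('h, q)\<close> up to a unique isometric
  isomorphism. Values of \<open>q\<close> at functions that are not square-integrable are irrelevant.
\<close>

definition is_L2 ::
  "'e measure \<Rightarrow> (('e \<Rightarrow> real) \<Rightarrow> 'h::{real_inner,complete_space}) \<Rightarrow> bool" where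
  "is_L2 M q \<longleftrightarrow>
     q ` square_integrable M = UNIV \<and>
     (\<forall>f \<in> square_integrable M. \<forall>g \<in> square_integrable M.
        (q f = q g \<longleftrightarrow> (AE x in M. f x = g x)) \<and>
        q (\<lambda>x. f x + g x) = q f + q g \<and>
        q f \<bullet> q g = (LINT x|M. f x * g x)) \<and>
     (\<forall>c. \<forall>f \<in> square_integrable M. q (\<lambda>x. c * f x) = c *\<^sub>R q f)"

section \<open>Linear operators with a domain\<close>

text \<open>
  An operator \<open>(A, D(A))\<close> is a subspace \<open>D(A)\<close> and a total function \<open>A\<close>,
  whose values outside \<open>D(A)\<close> carry no meaning.
\<close>

definition lin_op :: "'h::real_vector set \<Rightarrow> ('h \<Rightarrow> 'h) \<Rightarrow> bool" where
  "lin_op DA A \<longleftrightarrow> subspace DA \<and>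
     (\<forall>x\<in>DA. \<forall>y\<in>DA. A (x + y) = A x + A y) \<and>
     (\<forall>c. \<forall>x\<in>DA. A (c *\<^sub>R x) = c *\<^sub>R A x)"

definition op_graph :: "'h set \<Rightarrow> ('h \<Rightarrow> 'h) \<Rightarrow> ('h \<times> 'h) set" where
  "op_graph DA A = (\<lambda>x. (x, A x)) ` DA"

definition closed_op :: "'h::topological_space set \<Rightarrow> ('h \<Rightarrow> 'h) \<Rightarrow> bool" where
  "closed_op DA A \<longleftrightarrow> closed (op_graph DA A)"

definition symmetric_op :: "'h::real_inner set \<Rightarrow> ('h \<Rightarrow> 'h) \<Rightarrow> bool" where
  "symmetric_op DA A \<longleftrightarrow> (\<forall>x\<in>DA. \<forall>y\<in>DA. A x \<bullet> y = x \<bullet> A y)"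

definition antisymmetric_op :: "'h::real_inner set \<Rightarrow> ('h \<Rightarrow> 'h) \<Rightarrow> bool" where
  "antisymmetric_op DA A \<longleftrightarrow> (\<forall>x\<in>DA. \<forall>y\<in>DA. A x \<bullet> y = - (x \<bullet> A y))"

definition core_of :: "'h::topological_space set \<Rightarrow> 'h set \<Rightarrow> ('h \<Rightarrow> 'h) \<Rightarrow> bool" where
  "core_of D DL L \<longleftrightarrow> D \<subseteq> DL \<and> closure (op_graph D L) = op_graph DL L"

definition bounded_op :: "'h::real_normed_vector set \<Rightarrow> ('h \<Rightarrow> 'h) \<Rightarrow> bool" where
  "bounded_op DA A \<longleftrightarrow> (\<exists>C. \<forall>x\<in>DA. norm (A x) \<le> C * norm x)"

definition orthogonal_projection :: "('h::real_inner \<Rightarrow> 'h) \<Rightarrow> bool" where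
  "orthogonal_projection P \<longleftrightarrow>
     bounded_linear P \<and> (\<forall>x. P (P x) = P x) \<and> (\<forall>x y. P x \<bullet> y = x \<bullet> P y)"

text \<open>Only the values \<open>T t\<close> for \<open>t \<ge> 0\<close> are relevant.\<close>

definition C0_semigroup :: "(real \<Rightarrow> 'h::real_normed_vector \<Rightarrow> 'h) \<Rightarrow> bool" where
  "C0_semigroup T \<longleftrightarrow>
     (\<forall>t\<ge>0. bounded_linear (T t)) \<and>
     (\<forall>x. T 0 x = x) \<and>
     (\<forall>s\<ge>0. \<forall>t\<ge>0. \<forall>x. T (s + t) x = T s (T t x)) \<and>
     (\<forall>x. continuous_on {0..} (\<lambda>t. T t x))"

definition generator_of ::
  "(real \<Rightarrow> 'h::real_normed_vector \<Rightarrow> 'h) \<Rightarrow> 'h set \<Rightarrow> ('h \<Rightarrow> 'h) \<Rightarrow> bool" where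
  "generator_of T DL L \<longleftrightarrow>
     DL = {x. \<exists>y. ((\<lambda>t. (1 / t) *\<^sub>R (T t x - x)) \<longlongrightarrow> y) (at_right 0)} \<and>
     (\<forall>x\<in>DL. ((\<lambda>t. (1 / t) *\<^sub>R (T t x - x)) \<longlongrightarrow> L x) (at_right 0))"

section \<open>The adjoint and the operator B\<close>

definition adj_dom :: "'h::real_inner set \<Rightarrow> ('h \<Rightarrow> 'h) \<Rightarrow> 'h set" where
  "adj_dom DT T = {y. \<exists>z. \<forall>x\<in>DT. T x \<bullet> y = x \<bullet> z}"

text \<open>The vector \<open>z\<close> is unique if \<open>DT\<close> is dense.\<close>

definition adj :: "'h::real_inner set \<Rightarrow> ('h \<Rightarrow> 'h) \<Rightarrow> 'h \<Rightarrow> 'h" where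
  "adj DT T y = (THE z. \<forall>x\<in>DT. T x \<bullet> y = x \<bullet> z)"

text \<open>\<open>(I + T\<^sup>* T)\<^sup>-\<^sup>1 T\<^sup>*\<close>, where \<open>I + T\<^sup>* T\<close> has its natural domain.\<close>

definition pre_B :: "'h::real_inner set \<Rightarrow> ('h \<Rightarrow> 'h) \<Rightarrow> 'h \<Rightarrow> 'h" where
  "pre_B DT T y =
     the_inv_into {x \<in> DT. T x \<in> adj_dom DT T} (\<lambda>x. x + adj DT T (T x)) (adj DT T y)"

definition cont_lin_extension ::
  "'h::real_normed_vector set \<Rightarrow> ('h \<Rightarrow> 'h) \<Rightarrow> 'h \<Rightarrow> 'h" where
  "cont_lin_extension D0 B0 = (THE B. bounded_linear B \<and> (\<forall>x\<in>D0. B x = B0 x))"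

definition AP_dom :: "'h set \<Rightarrow> ('h \<Rightarrow> 'h) \<Rightarrow> 'h set" where
  "AP_dom DA P = {f. P f \<in> DA}"

definition B_op :: "'h::real_inner set \<Rightarrow> ('h \<Rightarrow> 'h) \<Rightarrow> ('h \<Rightarrow> 'h) \<Rightarrow> 'h \<Rightarrow> 'h" where
  "B_op DA A P =
     cont_lin_extension (adj_dom (AP_dom DA P) (A \<circ> P)) (pre_B (AP_dom DA P) (A \<circ> P))"

end

theory Submission
  imports Defs
begin

text \<open>
  Write \<open>T = AP\<close>. For \<open>y\<close> in the domain of \<open>T\<^sup>*\<close>, the vector \<open>z = By\<close> is characterised by
  \<open>z + T\<^sup>*Tz = T\<^sup>*y\<close>, that is, weakly, by \<open>(Tx, y - Tz) = (x, z)\<close> for all \<open>x\<close> in the domain of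
  \<open>T\<close>. The weak form makes sense for every \<open>y\<close> in \<open>H\<close>: it says that \<open>(z, Tz)\<close> is the orthogonal
  projection of \<open>(0, y)\<close> onto the graph of \<open>T\<close>, equivalently that \<open>z\<close> minimises
  \<open>\<parallel>z\<parallel>\<^sup>2 + \<parallel>Tz - y\<parallel>\<^sup>2\<close>. The graph is closed, so \<open>z\<close> exists for every \<open>y\<close>
  (\<open>normal_eq_exists\<close>); this yields the extension of \<open>B\<close> to all of \<open>H\<close> without a separate
  extension argument. Testing with \<open>x = z\<close> gives
  \<open>\<parallel>z\<parallel>\<^sup>2 + \<parallel>Tz\<parallel>\<^sup>2 = (y, Tz) \<le> \<parallel>y\<parallel>\<^sup>2 / 4 + \<parallel>Tz\<parallel>\<^sup>2\<close>, hence \<open>\<parallel>By\<parallel> \<le> \<parallel>y\<parallel> / 2\<close>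
  (\<open>normal_eq_norm_le\<close>), which is where the factor one half comes from.

  By antisymmetry of \<open>A\<close> and symmetry of \<open>P\<close>, \<open>T\<^sup>*g = - PAg\<close> for \<open>g\<close> in the domain of \<open>A\<close>. For
  \<open>f\<close> in \<open>D\<close> the hypothesis on \<open>PAS\<close> therefore reads \<open>T\<^sup>*Sf = M\<^sub>1 T\<^sup>*f\<close>, and \<open>PAP = 0\<close> on \<open>D\<close>
  reads \<open>T\<^sup>*Pf = 0\<close>. Since \<open>By\<close> depends on \<open>y\<close> only through \<open>T\<^sup>*y\<close>, this gives
  \<open>BSf = M\<^sub>1 Bf = M\<^sub>1 B(f - Pf)\<close>, and the bound on \<open>B\<close> finishes the proof, with \<open>P\<^sub>1 = P\<close>.
\<close>

section \<open>Orthogonal projection onto a closed subspace\<close>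

text \<open>
  In infinite dimension the nearest point cannot come from compactness of balls. Instead,
  by the parallelogram law a minimising sequence is Cauchy, because the midpoint of two of its
  terms lies in the subspace and so cannot be closer than the infimum.
\<close>

lemma closed_subspace_nearest_point:
  fixes x :: "'a::{real_inner,complete_space}"
  assumes V: "subspace V" "closed V"
  obtains v where "v \<in> V" "\<And>w. w \<in> V \<Longrightarrow> norm (x - v) \<le> norm (x - w)"
proof -
  define R where "R = (\<lambda>v. (norm (x - v))\<^sup>2) ` V"
  define d where "d = Inf R"
  have Rne: "R \<noteq> {}" and Rbdd: "bdd_below R"
    using subspace_0[OF V(1)] by (auto simp: R_def intro!: bdd_belowI[of _ 0])
  have d_le: "d \<le> (norm (x - v))\<^sup>2" if "v \<in> V" for v
    using that unfolding d_def
    by (intro cInf_lower[OF _ Rbdd]) (auto simp: R_def)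
  have "\<exists>v\<in>V. (norm (x - v))\<^sup>2 < d + 1 / Suc n" for n
    using cInf_lessD[OF Rne, of "d + 1 / Suc n"] by (auto simp: R_def d_def)
  then obtain v where vV: "\<And>n. v n \<in> V" and vd: "\<And>n. (norm (x - v n))\<^sup>2 < d + 1 / Suc n"
    by metis
  have close: "(norm (v m - v n))\<^sup>2 \<le> 2 / Suc m + 2 / Suc n" for m n
  proof -
    have par: "(norm (v m - v n))\<^sup>2 = 2 * (norm (x - v m))\<^sup>2 + 2 * (norm (x - v n))\<^sup>2
        - 4 * (norm (x - (1/2) *\<^sub>R (v m + v n)))\<^sup>2"
      unfolding power2_norm_eq_inner
      by (simp add: inner_diff inner_add inner_commute algebra_simps)
    have "d \<le> (norm (x - (1/2) *\<^sub>R (v m + v n)))\<^sup>2"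
      by (intro d_le subspace_scale[OF V(1)] subspace_add[OF V(1)] vV)
    with par vd[of m] vd[of n] show ?thesis by simp
  qed
  have "Cauchy v"
  proof (rule CauchyI)
    fix e :: real assume "e > 0"
    then obtain N where N: "4 / e\<^sup>2 < real N"
      using reals_Archimedean2 by blast
    have "norm (v m - v n) < e" if "m \<ge> N" "n \<ge> N" for m n
    proof -
      have pos: "0 < 4 / e\<^sup>2" using \<open>e > 0\<close> by simp
      have small: "2 / real (Suc k) < e\<^sup>2 / 2" if "k \<ge> N" for k
      proof -
        have "4 / e\<^sup>2 < real (Suc k)" using N that by linarith
        then show ?thesis using \<open>e > 0\<close> by (simp add: field_simps)
      qed
      have "(norm (v m - v n))\<^sup>2 < e\<^sup>2"
        using close[of m n] small[OF that(1)] small[OF that(2)] by linarith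
      then show ?thesis
        using \<open>e > 0\<close> power2_less_imp_less by fastforce
    qed
    then show "\<exists>N. \<forall>m\<ge>N. \<forall>n\<ge>N. norm (v m - v n) < e" by blast
  qed
  then obtain l where l: "v \<longlonglongrightarrow> l"
    using Cauchy_convergent_iff convergent_def by blast
  have lV: "l \<in> V"
    using closed_sequentially[OF V(2) _ l] vV by blast
  have "(\<lambda>n. d + 1 / real (Suc n)) \<longlonglongrightarrow> d + 0"
    using tendsto_add[OF tendsto_const LIMSEQ_inverse_real_of_nat] by (simp add: inverse_eq_divide)
  then have lim_d: "(\<lambda>n. d + 1 / real (Suc n)) \<longlonglongrightarrow> d" by simp
  have "(\<lambda>n. (norm (x - v n))\<^sup>2) \<longlonglongrightarrow> (norm (x - l))\<^sup>2"
    by (intro tendsto_intros l)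
  then have "(norm (x - l))\<^sup>2 \<le> d"
    by (rule LIMSEQ_le[OF _ lim_d]) (use less_imp_le[OF vd] in blast)
  then show thesis
    using that[OF lV] d_le by (meson norm_ge_zero order_trans power2_le_imp_le)
qed

lemma closed_subspace_orthogonal_projection:
  fixes x :: "'a::{real_inner,complete_space}"
  assumes V: "subspace V" "closed V"
  obtains v where "v \<in> V" "\<And>w. w \<in> V \<Longrightarrow> (x - v) \<bullet> w = 0"
proof -
  obtain v where v: "v \<in> V" "\<And>w. w \<in> V \<Longrightarrow> norm (x - v) \<le> norm (x - w)"
    using closed_subspace_nearest_point[OF V] by blast
  have "(x - v) \<bullet> w = 0" if w: "w \<in> V" for w
  proof -
    \<comment> \<open>At a nearest point of a convex set, the angle between \<open>x - v\<close> and any direction into the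
       set is not acute; in a subspace both \<open>w\<close> and \<open>- w\<close> are such directions.\<close>
    have "(x - v) \<bullet> (u - v) \<le> 0" if "u \<in> V" for u
      using any_closest_point_dot[OF subspace_imp_convex[OF V(1)] V(2) v(1) that] v(2)
      by (simp add: dist_norm)
    from this[of "v + w"] this[of "v - w"] show ?thesis
      using subspace_add[OF V(1) v(1) w] subspace_diff[OF V(1) v(1) w] by simp
  qed
  with v(1) that show thesis by blast
qed

section \<open>The weak normal equation\<close>

lemma lin_op_combination:
  assumes "lin_op DT T" "x \<in> DT" "y \<in> DT"
  shows "a *\<^sub>R x + b *\<^sub>R y \<in> DT" "T (a *\<^sub>R x + b *\<^sub>R y) = a *\<^sub>R T x + b *\<^sub>R T y"
  using assms by (auto simp: lin_op_def subspace_def)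

lemma subspace_op_graph:
  assumes "lin_op DT T"
  shows "subspace (op_graph DT T)"
proof -
  have "T 0 = 0" if "0 \<in> DT"
    using lin_op_combination(2)[OF assms that that, of 0 0] by simp
  moreover have "subspace DT" using assms by (simp add: lin_op_def)
  ultimately show ?thesis
    using assms by (auto simp: subspace_def op_graph_def lin_op_def image_iff zero_prod_def)
qed

text \<open>
  The weak form of \<open>z + T\<^sup>*Tz = T\<^sup>*y\<close>; unlike the strong form, it does not require \<open>y\<close> to lie in
  the domain of \<open>T\<^sup>*\<close>.
\<close>

definition normal_eq ::
  "'h::real_inner set \<Rightarrow> ('h \<Rightarrow> 'h) \<Rightarrow> 'h \<Rightarrow> 'h \<Rightarrow> bool" where
  "normal_eq DT T y z \<longleftrightarrow> z \<in> DT \<and> (\<forall>x\<in>DT. T x \<bullet> (y - T z) = x \<bullet> z)"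

text \<open>
  The equation says that \<open>(0, y) - (z, Tz)\<close> is orthogonal to the graph of \<open>T\<close>, so a solution is
  the first component of the projection of \<open>(0, y)\<close> onto this closed subspace of \<open>H \<times> H\<close>.
\<close>

lemma normal_eq_exists:
  fixes T :: "'h::{real_inner,complete_space} \<Rightarrow> 'h"
  assumes "lin_op DT T" "closed_op DT T"
  shows "\<exists>z. normal_eq DT T y z"
proof -
  obtain p where p: "p \<in> op_graph DT T" "\<And>w. w \<in> op_graph DT T \<Longrightarrow> ((0, y) - p) \<bullet> w = 0"
    using closed_subspace_orthogonal_projection subspace_op_graph assms
    unfolding closed_op_def by metis
  obtain z where z: "z \<in> DT" "p = (z, T z)" using p(1) by (auto simp: op_graph_def)
  have "T x \<bullet> (y - T z) = x \<bullet> z" if "x \<in> DT" for x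
    using p(2)[of "(x, T x)"] that by (simp add: z(2) op_graph_def inner_prod_def inner_commute)
  with z(1) show ?thesis by (auto simp: normal_eq_def)
qed

text \<open>
  Test the equation with \<open>x = z\<close> and absorb \<open>\<parallel>Tz\<parallel>\<^sup>2\<close> by \<open>ab \<le> a\<^sup>2 / 4 + b\<^sup>2\<close>.
\<close>

lemma normal_eq_norm_le:
  assumes "normal_eq DT T y z"
  shows "norm z \<le> norm y / 2"
proof -
  have "T z \<bullet> y = (norm z)\<^sup>2 + (norm (T z))\<^sup>2"
    using assms by (auto simp: normal_eq_def inner_diff_right power2_norm_eq_inner)
  moreover have "T z \<bullet> y \<le> norm (T z) * norm y" by (rule norm_cauchy_schwarz)
  moreover have "0 \<le> (norm y / 2 - norm (T z))\<^sup>2" by simp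
  ultimately have "(norm z)\<^sup>2 \<le> (norm y / 2)\<^sup>2"
    by (simp add: power2_eq_square algebra_simps)
  then show ?thesis by (rule power2_le_imp_le) simp
qed

lemma normal_eq_combination:
  assumes "lin_op DT T" "normal_eq DT T y z" "normal_eq DT T y' z'"
  shows "normal_eq DT T (a *\<^sub>R y + b *\<^sub>R y') (a *\<^sub>R z + b *\<^sub>R z')"
proof -
  have z: "z \<in> DT" "z' \<in> DT" using assms(2,3) by (auto simp: normal_eq_def)
  have "T x \<bullet> (a *\<^sub>R y + b *\<^sub>R y' - T (a *\<^sub>R z + b *\<^sub>R z')) = x \<bullet> (a *\<^sub>R z + b *\<^sub>R z')"
    if "x \<in> DT" for x
  proof -
    have "a *\<^sub>R y + b *\<^sub>R y' - T (a *\<^sub>R z + b *\<^sub>R z') = a *\<^sub>R (y - T z) + b *\<^sub>R (y' - T z')"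
      by (simp add: lin_op_combination(2)[OF assms(1) z] algebra_simps)
    moreover have "T x \<bullet> (y - T z) = x \<bullet> z" "T x \<bullet> (y' - T z') = x \<bullet> z'"
      using assms(2,3) that by (auto simp: normal_eq_def)
    ultimately show ?thesis by (simp add: inner_add_right)
  qed
  then show ?thesis
    using lin_op_combination(1)[OF assms(1) z] by (auto simp: normal_eq_def)
qed

text \<open>The difference of two solutions solves the equation with right-hand side \<open>0\<close>.\<close>

lemma normal_eq_unique:
  assumes "lin_op DT T" "normal_eq DT T y z" "normal_eq DT T y z'"
  shows "z = z'"
  using normal_eq_norm_le[OF normal_eq_combination[OF assms, of 1 "-1"]] by simp

text \<open>
  The solution depends on \<open>y\<close> only through the functional \<open>x \<mapsto> (Tx, y)\<close>, that is, through \<open>T\<^sup>*y\<close>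
  where this is defined.
\<close>

lemma normal_eq_cong:
  assumes "\<And>x. x \<in> DT \<Longrightarrow> T x \<bullet> y = T x \<bullet> y'"
  shows "normal_eq DT T y z \<longleftrightarrow> normal_eq DT T y' z"
  using assms by (auto simp: normal_eq_def inner_diff_right)

lemma ex_bounded_linear_normal_eq:
  fixes T :: "'h::{real_inner,complete_space} \<Rightarrow> 'h"
  assumes "lin_op DT T" "closed_op DT T"
  obtains B where "bounded_linear B" "\<And>y. normal_eq DT T y (B y)"
proof -
  obtain B where B: "\<And>y. normal_eq DT T y (B y)"
    using normal_eq_exists[OF assms] by metis
  have "B (a *\<^sub>R x + b *\<^sub>R y) = a *\<^sub>R B x + b *\<^sub>R B y" for a b x y
    using normal_eq_unique[OF assms(1) B normal_eq_combination[OF assms(1) B B]] .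
  from this[of 1 _ 1] this[of _ _ 0] have "bounded_linear B"
    using normal_eq_norm_le[OF B]
    by (intro bounded_linear_intro[where K = "1/2"]) (auto simp: mult.commute)
  with B that show thesis by blast
qed

section \<open>The operator B\<close>

lemma inner_eq_on_dense_imp_eq:
  fixes u v :: "'h::real_inner"
  assumes "closure X = UNIV" "\<And>x. x \<in> X \<Longrightarrow> x \<bullet> u = x \<bullet> v"
  shows "u = v"
proof -
  have "(\<lambda>x. x \<bullet> (u - v)) (u - v) = 0"
    by (rule continuous_constant_on_closure[where S = X])
      (use assms in \<open>auto simp: inner_diff_right intro!: continuous_intros\<close>)
  then show ?thesis by simp
qed

lemma adj_eq:
  fixes T :: "'h::real_inner \<Rightarrow> 'h"
  assumes "closure DT = UNIV" "\<And>x. x \<in> DT \<Longrightarrow> T x \<bullet> y = x \<bullet> z"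
  shows "adj DT T y = z"
  unfolding adj_def
proof (rule the_equality)
  show "z' = z" if "\<forall>x\<in>DT. T x \<bullet> y = x \<bullet> z'" for z'
    using inner_eq_on_dense_imp_eq[OF assms(1), of z' z] that assms(2) by force
qed (use assms in blast)

lemma adj_inner:
  fixes T :: "'h::real_inner \<Rightarrow> 'h"
  assumes "closure DT = UNIV" "y \<in> adj_dom DT T" "x \<in> DT"
  shows "T x \<bullet> y = x \<bullet> adj DT T y"
proof -
  obtain z where "\<forall>x\<in>DT. T x \<bullet> y = x \<bullet> z" using assms(2) by (auto simp: adj_dom_def)
  with adj_eq[OF assms(1), of T y z] assms(3) show ?thesis by simp
qed

text \<open>
  On the domain of \<open>T\<^sup>*\<close> the weak and the strong equation agree: \<open>y - Tz\<close> lies in this domain by the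
  weak equation, hence so does \<open>Tz\<close>. Injectivity of \<open>I + T\<^sup>*T\<close> is uniqueness for the weak equation.
\<close>

lemma pre_B_eq:
  fixes T :: "'h::real_inner \<Rightarrow> 'h"
  assumes T: "lin_op DT T" "closure DT = UNIV"
    and y: "y \<in> adj_dom DT T" and z: "normal_eq DT T y z"
  shows "pre_B DT T y = z"
proof -
  let ?X = "{x \<in> DT. T x \<in> adj_dom DT T}"
  let ?F = "\<lambda>x. x + adj DT T (T x)"
  have zD: "z \<in> DT" using z by (simp add: normal_eq_def)
  have Tz: "T x \<bullet> T z = x \<bullet> (adj DT T y - z)" if "x \<in> DT" for x
    using z adj_inner[OF T(2) y that] that
    by (auto simp: normal_eq_def inner_diff_right algebra_simps)
  have "z \<in> ?X" using zD Tz by (auto simp: adj_dom_def)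
  moreover have "?F z = adj DT T y"
    using adj_eq[OF T(2) Tz] by simp
  moreover have "inj_on ?F ?X"
  proof (rule inj_onI)
    fix u v assume uv: "u \<in> ?X" "v \<in> ?X" "?F u = ?F v"
    \<comment> \<open>The difference \<open>w = u - v\<close> satisfies \<open>w + T\<^sup>*Tw = 0\<close>, the equation for \<open>y = 0\<close>.\<close>
    have "T x \<bullet> (0 - T (1 *\<^sub>R u + (-1) *\<^sub>R v)) = x \<bullet> (1 *\<^sub>R u + (-1) *\<^sub>R v)" if x: "x \<in> DT" for x
    proof -
      have "T (1 *\<^sub>R u + (-1) *\<^sub>R v) = T u - T v"
        using lin_op_combination(2)[OF T(1), of u v 1 "-1"] uv by simp
      moreover have "T x \<bullet> T u = x \<bullet> adj DT T (T u)" "T x \<bullet> T v = x \<bullet> adj DT T (T v)"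
        using adj_inner[OF T(2) _ x] uv by auto
      moreover have "u - v = adj DT T (T v) - adj DT T (T u)"
        using uv(3) by (simp add: algebra_simps)
      ultimately show ?thesis by (simp add: inner_diff_right)
    qed
    then have "normal_eq DT T 0 (1 *\<^sub>R u + (-1) *\<^sub>R v)"
      using lin_op_combination(1)[OF T(1)] uv unfolding normal_eq_def by blast
    from normal_eq_norm_le[OF this] show "u = v" by simp
  qed
  ultimately show ?thesis
    unfolding pre_B_def by (intro the_inv_into_f_eq)
qed

lemma cont_lin_extension_eq:
  fixes B :: "'h::real_normed_vector \<Rightarrow> 'h"
  assumes "closure X = UNIV" "bounded_linear B" "\<And>x. x \<in> X \<Longrightarrow> B x = B0 x"
  shows "cont_lin_extension X B0 = B"
  unfolding cont_lin_extension_def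
proof (rule the_equality)
  fix C assume C: "bounded_linear C \<and> (\<forall>x\<in>X. C x = B0 x)"
  have "continuous_on (closure X) (\<lambda>x. C x - B x)"
    using assms(2) C by (intro continuous_on_diff linear_continuous_on) auto
  moreover have "C x - B x = 0" if "x \<in> X" for x
    using that assms(3) C by simp
  ultimately have "C x - B x = 0" for x
    using continuous_constant_on_closure[of X "\<lambda>x. C x - B x" 0 x] assms(1) by simp
  then show "C = B" by (auto simp: fun_eq_iff)
qed (use assms in blast)

text \<open>
  The solution map of the weak equation is bounded, linear and defined on all of \<open>H\<close>, so it is
  the extension sought. From here on \<open>B\<close> is used only through the weak equation.
\<close>

lemma cont_lin_extension_pre_B_normal_eq:
  fixes T :: "'h::{real_inner,complete_space} \<Rightarrow> 'h"
  assumes "lin_op DT T" "closed_op DT T" "closure DT = UNIV" "closure (adj_dom DT T) = UNIV"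
  shows "normal_eq DT T y (cont_lin_extension (adj_dom DT T) (pre_B DT T) y)"
proof -
  obtain B where B: "bounded_linear B" "\<And>y. normal_eq DT T y (B y)"
    using ex_bounded_linear_normal_eq[OF assms(1,2)] by blast
  have "cont_lin_extension (adj_dom DT T) (pre_B DT T) = B"
    by (rule cont_lin_extension_eq[OF assms(4) B(1)])
      (simp add: pre_B_eq[OF assms(1,3) _ B(2)])
  with B(2) show ?thesis by simp
qed

section \<open>The operator AP\<close>

lemma lin_op_comp_bounded_linear:
  assumes "lin_op DA A" "bounded_linear P"
  shows "lin_op (AP_dom DA P) (A \<circ> P)"
proof -
  interpret P: bounded_linear P by fact
  show ?thesis
    using assms(1) by (auto simp: lin_op_def AP_dom_def subspace_def P.add P.scaleR P.zero)
qed

text \<open>The graph of \<open>AP\<close> is the preimage of the graph of \<open>A\<close> under \<open>(x, y) \<mapsto> (Px, y)\<close>.\<close>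

lemma closed_op_comp_bounded_linear:
  assumes "closed_op DA A" "bounded_linear P"
  shows "closed_op (AP_dom DA P) (A \<circ> P)"
proof -
  have "op_graph (AP_dom DA P) (A \<circ> P) = (\<lambda>w. (P (fst w), snd w)) -` op_graph DA A"
    by (auto simp: op_graph_def AP_dom_def image_iff)
  moreover have "continuous_on UNIV (\<lambda>w. (P (fst w), snd w))"
    by (intro continuous_intros bounded_linear.continuous_on[OF assms(2)])
  ultimately show ?thesis
    using assms(1) closed_vimage by (metis closed_op_def)
qed

text \<open>In other words, \<open>(AP)\<^sup>* = - PA\<close> on the domain of \<open>A\<close>.\<close>

lemma inner_AP:
  assumes "antisymmetric_op DA A" "orthogonal_projection P" "x \<in> AP_dom DA P" "g \<in> DA"
  shows "(A \<circ> P) x \<bullet> g = x \<bullet> (- P (A g))"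
  using assms by (simp add: antisymmetric_op_def orthogonal_projection_def AP_dom_def)

theorem lemma2p14:
  fixes M :: "'e measure"
    and q :: "('e \<Rightarrow> real) \<Rightarrow> 'h::{real_inner,complete_space}"
    and T :: "real \<Rightarrow> 'h \<Rightarrow> 'h"
    and L S A P P\<^sub>S :: "'h \<Rightarrow> 'h"
    and DL DS DA D :: "'h set"
    and one :: 'h
    and M\<^sub>1 :: real
  assumes D1: "prob_space M" "is_L2 M q"
    and one: "one = q (\<lambda>_. 1)"
    and D2: "lin_op DL L" "C0_semigroup T" "generator_of T DL L"
    and D3: "subspace D" "D \<subseteq> DL" "closure D = UNIV" "core_of D DL L"
    and D4: "lin_op DS S" "symmetric_op DS S"
            "lin_op DA A" "closed_op DA A" "antisymmetric_op DA A"
            "D \<subseteq> DS \<inter> DA" "\<forall>f\<in>D. L f = S f - A f"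
    and D5: "orthogonal_projection P" "range P \<subseteq> DS" "\<forall>f. S (P f) = 0"
            "P ` D \<subseteq> DA" "(A \<circ> P) ` D \<subseteq> DA"
    and PS: "\<forall>f. P\<^sub>S f = P f + (f \<bullet> one) *\<^sub>R one"
    and D6: "\<forall>f\<in>D. L f \<bullet> one = 0"
    and D7: "one \<in> DL" "L one = 0"
    and PAP: "\<forall>f\<in>D. P (A (P f)) = 0"
    and SD: "S ` D \<subseteq> DA"
    and PAS: "\<forall>f\<in>D. P (A (S f)) = M\<^sub>1 *\<^sub>R P (A f)"
  shows "bounded_op D (B_op DA A P \<circ> S) \<and>
         (\<exists>P\<^sub>1\<in>{P, P\<^sub>S}. \<forall>f\<in>D.
            norm (B_op DA A P (S f)) \<le> 1 / 2 * \<bar>M\<^sub>1\<bar> * norm (f - P\<^sub>1 f))"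
proof -
  let ?T = "A \<circ> P" and ?DT = "AP_dom DA P" and ?B = "B_op DA A P"
  have P: "bounded_linear P" using D5(1) by (simp add: orthogonal_projection_def)
  have lin: "lin_op ?DT ?T" by (rule lin_op_comp_bounded_linear[OF D4(3) P])
  have adj: "?T x \<bullet> g = x \<bullet> (- P (A g))" if "x \<in> ?DT" "g \<in> DA" for x g
    by (rule inner_AP[OF D4(5) D5(1) that])
  have "D \<subseteq> ?DT" using D5(4) by (auto simp: AP_dom_def)
  then have dense: "closure ?DT = UNIV" using D3(3) closure_mono by blast
  have "DA \<subseteq> adj_dom ?DT ?T" using adj unfolding adj_dom_def by blast
  then have "D \<subseteq> adj_dom ?DT ?T" using D4(6) by blast
  then have adj_dense: "closure (adj_dom ?DT ?T) = UNIV" using D3(3) closure_mono by blast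
  have B: "normal_eq ?DT ?T y (?B y)" for y
    unfolding B_op_def
    by (rule cont_lin_extension_pre_B_normal_eq[OF lin
          closed_op_comp_bounded_linear[OF D4(4) P] dense adj_dense])
  have key: "norm (?B (S f)) \<le> 1 / 2 * \<bar>M\<^sub>1\<bar> * norm (f - P f)" if f: "f \<in> D" for f
  proof -
    have DA: "f \<in> DA" "P f \<in> DA" "S f \<in> DA" using f D4(6) D5(4) SD by auto
    \<comment> \<open>\<open>Sf\<close> and \<open>M\<^sub>1 (f - Pf)\<close> have the same image under \<open>(AP)\<^sup>*\<close>.\<close>
    have "?T x \<bullet> S f = ?T x \<bullet> (M\<^sub>1 *\<^sub>R (f - P f))" if "x \<in> ?DT" for x
      using adj[OF that DA(1)] adj[OF that DA(2)] adj[OF that DA(3)] PAP PAS f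
      by (simp add: inner_diff_right)
    then have "normal_eq ?DT ?T (M\<^sub>1 *\<^sub>R (f - P f)) (?B (S f))"
      using normal_eq_cong B by blast
    from normal_eq_norm_le[OF this] show ?thesis by simp
  qed
  obtain K where K: "\<And>x. norm (P x) \<le> norm x * K"
    using bounded_linear.bounded[OF P] by blast
  have "norm (?B (S f)) \<le> (1 / 2 * \<bar>M\<^sub>1\<bar> * (1 + K)) * norm f" if "f \<in> D" for f
  proof -
    have "norm (f - P f) \<le> (1 + K) * norm f"
      using norm_triangle_ineq4[of f "P f"] K[of f] by (simp add: algebra_simps)
    then have "1 / 2 * \<bar>M\<^sub>1\<bar> * norm (f - P f) \<le> 1 / 2 * \<bar>M\<^sub>1\<bar> * ((1 + K) * norm f)"
      by (intro mult_left_mono) auto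
    with key[OF that] show ?thesis by (simp add: mult.assoc)
  qed
  then have "bounded_op D (?B \<circ> S)" unfolding bounded_op_def comp_def by blast
  with key show ?thesis by blast
qed

end
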